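(* An optimal boundary-weighted quadrature rule exists: there exist a finite set of points $X\subset K$, weights $w_{\mathbf x}\ge 0$ ($\mathbf x\in X$) and a number $W^\star>0$ such that $$\mathcal C(U)=\sum_{\mathbf x\in X}w_{\mathbf x}U(\mathbf x)+W^\star\,\mathcal B(U)\qquad\text{for all }U\in\mathcal V,$$ and $M^\star=(W^\star)^{-1}$.
   Context: $K\subset\mathbb R^D$ is a compact mesh cell (with nonempty interior and boundary of positive finite area), and $\mathcal V$ is a finite-dimensional space of polynomials containing all polynomials in $D$ variables of degree at most $k\ge 0$. $\mathcal C(U):=\int_K U$ and $\mathcal B(U):=\oint_{\partial K}U$. $\mathcal V_K^+:=\{U\in\mathcal V: U\ge0\text{ in }K,\ \mathcal C(U)>0\}$, and $M^\star:=\sup_{U\in\mathcal V_K^+}\frac{\mathcal B(U)}{\mathcal C(U)}$ is the optimal interior weight. *)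

theory Defs
  imports "HOL-Analysis.Analysis" "HOL-Library.Function_Algebras"
begin

section \<open>Spaces of polynomials in \<open>D = CARD('n)\<close> variables\<close>

interpretation fun_vs: vector_space "\<lambda>(c::real) (U::'a \<Rightarrow> real) x. c * U x"
  by unfold_locales (auto simp: fun_eq_iff algebra_simps)

definition monomial_fun :: "('n::finite \<Rightarrow> nat) \<Rightarrow> real ^ 'n \<Rightarrow> real" where
  "monomial_fun \<alpha> x = (\<Prod>i\<in>UNIV. (x $ i) ^ \<alpha> i)"

definition polynomials_degree_le :: "nat \<Rightarrow> (real ^ 'n::finite \<Rightarrow> real) set" where
  "polynomials_degree_le k = fun_vs.span {monomial_fun \<alpha> |\<alpha>. (\<Sum>i\<in>UNIV. \<alpha> i) \<le> k}"

definition finite_dim_polynomial_space :: "(real ^ 'n::finite \<Rightarrow> real) set \<Rightarrow> bool" where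
  "finite_dim_polynomial_space V \<longleftrightarrow>
     (\<forall>U\<in>V. real_polynomial_function U) \<and>
     fun_vs.subspace V \<and> (\<exists>B. finite B \<and> fun_vs.span B = V)"


section \<open>Hausdorff measure\<close>

text \<open>
  Surface measure on a boundary is the Hausdorff measure of dimension \<open>D - 1\<close>, normalised so that
  it agrees with the usual surface area (length for \<open>D = 2\<close>, number of points for \<open>D = 1\<close>).
  The empty set gets gauge 0 separately because of \<open>0 ^ 0 = 1\<close>. Covers are required to be bounded
  because \<^const>\<open>diameter\<close> is unspecified on unbounded sets.
\<close>

definition hausdorff_gauge :: "nat \<Rightarrow> 'a::metric_space set \<Rightarrow> ennreal" where
  "hausdorff_gauge s E =
     (if E = {} then 0 else ennreal (unit_ball_vol (real s) * (diameter E / 2) ^ s))"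

definition small_covers :: "real \<Rightarrow> 'a::metric_space set \<Rightarrow> (nat \<Rightarrow> 'a set) set" where
  "small_covers \<delta> A = {E. A \<subseteq> (\<Union>i. E i) \<and> (\<forall>i. bounded (E i) \<and> diameter (E i) \<le> \<delta>)}"

definition hausdorff_content :: "nat \<Rightarrow> real \<Rightarrow> 'a::metric_space set \<Rightarrow> ennreal" where
  "hausdorff_content s \<delta> A = (INF E\<in>small_covers \<delta> A. \<Sum>i. hausdorff_gauge s (E i))"

definition hausdorff_outer :: "nat \<Rightarrow> 'a::metric_space set \<Rightarrow> ennreal" where
  "hausdorff_outer s A = (SUP \<delta>\<in>{0<..}. hausdorff_content s \<delta> A)"

definition hausdorff_measure :: "nat \<Rightarrow> 'a::metric_space measure" where
  "hausdorff_measure s = measure_of UNIV (sets borel) (hausdorff_outer s)"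

lemma space_hausdorff_measure [simp]: "space (hausdorff_measure s) = UNIV"
  by (simp add: hausdorff_measure_def space_measure_of_conv)

lemma sets_hausdorff_measure [simp, measurable_cong]:
  "sets (hausdorff_measure s) = sets (borel :: 'a::metric_space measure)"
  unfolding hausdorff_measure_def
  by (metis sets.sigma_sets_eq sets_measure_of space_borel subset_Pow_Union sets.space_closed)

text \<open>
  \<^const>\<open>measure_of\<close> would silently return the null measure if \<^const>\<open>hausdorff_outer\<close> were not
  countably additive on Borel sets. The rest of this section shows that it is
  (Caratheodory's criterion for metric outer measures).
\<close>

lemma hausdorff_content_empty: "0 < \<delta> \<Longrightarrow> hausdorff_content s \<delta> {} = 0"
  unfolding hausdorff_content_def
  by (intro antisym INF_lower2[of "\<lambda>_. {}"]) (auto simp: small_covers_def hausdorff_gauge_def)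

lemma hausdorff_content_mono: "A \<subseteq> B \<Longrightarrow> hausdorff_content s \<delta> A \<le> hausdorff_content s \<delta> B"
  unfolding hausdorff_content_def by (intro INF_superset_mono) (auto simp: small_covers_def)

lemma hausdorff_content_antimono:
  "\<delta> \<le> \<delta>' \<Longrightarrow> hausdorff_content s \<delta>' A \<le> hausdorff_content s \<delta> A"
  unfolding hausdorff_content_def
  by (intro INF_superset_mono) (auto simp: small_covers_def intro: order_trans)

lemma hausdorff_content_subadditive:
  "hausdorff_content s \<delta> (\<Union>i. A i) \<le> (\<Sum>n. hausdorff_content s \<delta> (A n))"
proof (rule ennreal_le_epsilon)
  let ?H = "hausdorff_content s \<delta>" and ?g = "hausdorff_gauge s"
  fix e :: real assume "0 < e" "(\<Sum>n. ?H (A n)) < top"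
  then have *: "\<And>n. ?H (A n) < ?H (A n) + e * (1/2) ^ Suc n"
    by (auto simp add: less_top dest!: ennreal_suminf_lessD)
  have "\<exists>E\<in>small_covers \<delta> (A n). (\<Sum>i. ?g (E i)) < ?H (A n) + e * (1/2) ^ Suc n" for n
    using *[of n] unfolding hausdorff_content_def INF_less_iff .
  then obtain E where E: "\<And>n. E n \<in> small_covers \<delta> (A n)"
    and Ele: "\<And>n. (\<Sum>i. ?g (E n i)) < ?H (A n) + e * (1/2) ^ Suc n"
    by metis
  define C where "C = case_prod E o prod_decode"
  have "C \<in> small_covers \<delta> (\<Union>i. A i)"
    unfolding small_covers_def
  proof (intro CollectI conjI allI subsetI)
    fix x assume "x \<in> (\<Union>i. A i)"
    then obtain n i where "x \<in> E n i" using E by (force simp: small_covers_def)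
    then have "x \<in> C (prod_encode (n, i))" by (simp add: C_def)
    then show "x \<in> (\<Union>i. C i)" by blast
  qed (use E in \<open>auto simp: C_def small_covers_def split: prod.split\<close>)
  then have "?H (\<Union>i. A i) \<le> (\<Sum>i. ?g (C i))"
    unfolding hausdorff_content_def by (rule INF_lower)
  also have "\<dots> = (\<Sum>n. \<Sum>i. ?g (E n i))"
    using suminf_ennreal_2dimen[of "\<lambda>n. \<Sum>i. ?g (E n i)" "\<lambda>(n, i). ?g (E n i)"]
    by (simp add: C_def comp_def split_def)
  also have "\<dots> \<le> (\<Sum>n. ?H (A n) + e * (1/2) ^ Suc n)"
    using Ele by (intro suminf_le) (auto intro: less_imp_le)
  also have "\<dots> = (\<Sum>n. ?H (A n)) + (\<Sum>n. ennreal e * ennreal ((1/2) ^ Suc n))"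
    using \<open>0 < e\<close>
    by (subst suminf_add[symmetric])
       (auto simp del: ennreal_suminf_cmult simp add: ennreal_mult[symmetric])
  also have "\<dots> = (\<Sum>n. ?H (A n)) + e"
    unfolding ennreal_suminf_cmult
    by (subst suminf_ennreal_eq[OF zero_le_power power_half_series]) auto
  finally show "?H (\<Union>i. A i) \<le> (\<Sum>n. ?H (A n)) + e" .
qed

lemma hausdorff_outer_Union: "hausdorff_outer s (\<Union>i::nat. A i) \<le> (\<Sum>i. hausdorff_outer s (A i))"
  unfolding hausdorff_outer_def[of s "\<Union>i. A i"]
proof (rule SUP_least)
  fix \<delta> :: real assume "\<delta> \<in> {0<..}"
  then have "(\<Sum>n. hausdorff_content s \<delta> (A n)) \<le> (\<Sum>i. hausdorff_outer s (A i))"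
    unfolding hausdorff_outer_def by (intro suminf_le SUP_upper) auto
  with hausdorff_content_subadditive
  show "hausdorff_content s \<delta> (\<Union>i. A i) \<le> (\<Sum>i. hausdorff_outer s (A i))"
    by (rule order_trans)
qed

lemma outer_measure_space_hausdorff: "outer_measure_space UNIV (hausdorff_outer s)"
  unfolding outer_measure_space_def
proof (intro conjI)
  show "positive UNIV (hausdorff_outer s)"
    by (auto simp: positive_def hausdorff_outer_def hausdorff_content_empty)
  show "increasing UNIV (hausdorff_outer s)"
    unfolding increasing_def hausdorff_outer_def by (auto intro!: SUP_mono' hausdorff_content_mono)
  show "countably_subadditive UNIV (hausdorff_outer s)"
    by (auto simp: countably_subadditive_def hausdorff_outer_Union)
qed

lemma hausdorff_outer_mono: "A \<subseteq> B \<Longrightarrow> hausdorff_outer s A \<le> hausdorff_outer s B"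
  using outer_measure_space_hausdorff by (auto simp: outer_measure_space_def increasing_def)

lemma hausdorff_outer_empty [simp]: "hausdorff_outer s {} = 0"
  using outer_measure_space_hausdorff by (auto simp: outer_measure_space_def positive_def)

lemma hausdorff_outer_Un: "hausdorff_outer s (A \<union> B) \<le> hausdorff_outer s A + hausdorff_outer s B"
proof -
  have "(\<Union>i. case_nat A (case_nat B (\<lambda>_. {})) i) = A \<union> B"
    by (auto split: nat.splits)
  moreover have "(\<Sum>i. hausdorff_outer s (case_nat A (case_nat B (\<lambda>_. {})) i))
      = (\<Sum>i<2. hausdorff_outer s (case_nat A (case_nat B (\<lambda>_. {})) i))"
    by (intro suminf_finite) (auto split: nat.splits)
  ultimately show ?thesis
    using hausdorff_outer_Union[of s "case_nat A (case_nat B (\<lambda>_. {}))"]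
    by (simp add: numeral_2_eq_2)
qed

lemma hausdorff_content_separated:
  assumes sep: "\<And>x y. x \<in> A \<Longrightarrow> y \<in> B \<Longrightarrow> \<delta> < dist x y"
  shows "hausdorff_content s \<delta> A + hausdorff_content s \<delta> B \<le> hausdorff_content s \<delta> (A \<union> B)"
  unfolding hausdorff_content_def[of s \<delta> "A \<union> B"]
proof (rule INF_greatest)
  fix E assume E: "E \<in> small_covers \<delta> (A \<union> B)"
  let ?g = "hausdorff_gauge s"
  define F G where "F = (\<lambda>i. if E i \<inter> A = {} then {} else E i)"
    and "G = (\<lambda>i. if E i \<inter> B = {} then {} else E i)"
  have d: "0 \<le> \<delta>"
    using E diameter_ge_0 by (force simp: small_covers_def)
  have "F \<in> small_covers \<delta> A" "G \<in> small_covers \<delta> B"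
    using E d by (auto simp: small_covers_def F_def G_def subset_iff split: if_splits) blast+
  then have "hausdorff_content s \<delta> A + hausdorff_content s \<delta> B \<le> (\<Sum>i. ?g (F i)) + (\<Sum>i. ?g (G i))"
    unfolding hausdorff_content_def by (intro add_mono INF_lower)
  also have "\<dots> = (\<Sum>i. ?g (F i) + ?g (G i))"
    by (intro suminf_add) auto
  also have "\<dots> \<le> (\<Sum>i. ?g (E i))"
  proof (intro suminf_le)
    fix i
    have "E i \<inter> A = {} \<or> E i \<inter> B = {}"
    proof (rule ccontr)
      assume "\<not> ?thesis"
      then obtain x y where xy: "x \<in> E i" "x \<in> A" "y \<in> E i" "y \<in> B" by blast
      have "dist x y \<le> diameter (E i)"
        using E xy by (intro diameter_bounded_bound) (auto simp: small_covers_def)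
      also have "\<dots> \<le> \<delta>" using E by (auto simp: small_covers_def)
      finally show False using sep[OF xy(2,4)] by simp
    qed
    then show "?g (F i) + ?g (G i) \<le> ?g (E i)"
      by (auto simp: F_def G_def hausdorff_gauge_def)
  qed auto
  finally show "hausdorff_content s \<delta> A + hausdorff_content s \<delta> B \<le> (\<Sum>i. ?g (E i))" .
qed

lemma hausdorff_outer_separated:
  assumes d: "0 < d" and sep: "\<And>x y. x \<in> A \<Longrightarrow> y \<in> B \<Longrightarrow> d \<le> dist x y"
  shows "hausdorff_outer s A + hausdorff_outer s B \<le> hausdorff_outer s (A \<union> B)"
proof -
  have *: "hausdorff_content s \<delta>1 A + hausdorff_content s \<delta>2 B \<le> hausdorff_outer s (A \<union> B)"
    if "0 < \<delta>1" "0 < \<delta>2" for \<delta>1 \<delta>2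
  proof -
    define \<delta> where "\<delta> = min (d / 2) (min \<delta>1 \<delta>2)"
    have \<delta>: "0 < \<delta>" "\<delta> < d" "\<delta> \<le> \<delta>1" "\<delta> \<le> \<delta>2" using that d by (auto simp: \<delta>_def)
    have "hausdorff_content s \<delta>1 A + hausdorff_content s \<delta>2 B
        \<le> hausdorff_content s \<delta> A + hausdorff_content s \<delta> B"
      using \<delta> by (intro add_mono hausdorff_content_antimono)
    also have "\<dots> \<le> hausdorff_content s \<delta> (A \<union> B)"
      using sep \<delta> by (intro hausdorff_content_separated) (meson less_le_trans)
    also have "\<dots> \<le> hausdorff_outer s (A \<union> B)"
      unfolding hausdorff_outer_def using \<delta> by (intro SUP_upper) auto
    finally show ?thesis .
  qed
  have ne: "{0::real<..} \<noteq> {}" by auto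
  have "hausdorff_outer s A + hausdorff_content s \<delta>2 B \<le> hausdorff_outer s (A \<union> B)"
    if "0 < \<delta>2" for \<delta>2
    unfolding hausdorff_outer_def[of s A] ennreal_SUP_add_left[OF ne, symmetric]
    using * that by (intro SUP_least) auto
  then show ?thesis
    unfolding hausdorff_outer_def[of s B] add.commute[of "hausdorff_outer s A"]
      ennreal_SUP_add_left[OF ne, symmetric]
    by (intro SUP_least) (auto simp: add.commute)
qed

lemma hausdorff_outer_infdist_separated:
  assumes "b < a" "\<And>x. x \<in> S \<Longrightarrow> a \<le> infdist x C" "\<And>y. y \<in> T \<Longrightarrow> infdist y C \<le> b"
  shows "hausdorff_outer s S + hausdorff_outer s T \<le> hausdorff_outer s (S \<union> T)"
proof (rule hausdorff_outer_separated[of "a - b"])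
  fix x y assume "x \<in> S" "y \<in> T"
  then show "a - b \<le> dist x y"
    using assms(2)[of x] assms(3)[of y] infdist_triangle[of x C y] by linarith
qed (use assms in simp)

lemma hausdorff_outer_closed_split:
  assumes "closed C"
  shows "hausdorff_outer s (A \<inter> C) + hausdorff_outer s (A - C) = hausdorff_outer s A"
proof (rule antisym)
  let ?H = "hausdorff_outer s"
  have "?H A \<le> ?H ((A \<inter> C) \<union> (A - C))" by (intro hausdorff_outer_mono) auto
  also have "\<dots> \<le> ?H (A \<inter> C) + ?H (A - C)" by (rule hausdorff_outer_Un)
  finally show "?H A \<le> ?H (A \<inter> C) + ?H (A - C)" .
  show "?H (A \<inter> C) + ?H (A - C) \<le> ?H A"
  proof (cases "C = {} \<or> ?H A = top")
    case True then show ?thesis by auto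
  next
    case False
    then have "C \<noteq> {}" and fin: "?H A < top" by (auto simp: less_top)
    define r where "r n = inverse (real (Suc n))" for n
    have r_less: "r m < r n" if "n < m" for n m
      using that by (simp add: r_def)
    have r_le: "r m \<le> r n" if "n \<le> m" for n m
      using that by (simp add: r_def)
    define S R where "S n = {x\<in>A. r n \<le> infdist x C}"
      and "R n = {x\<in>A. r (Suc n) \<le> infdist x C \<and> infdist x C \<le> r n}" for n
    have alt: "(\<Sum>j<n. ?H (R (2*j + p))) \<le> ?H (\<Union>j<n. R (2*j + p))" for n p
    proof (induction n)
      case (Suc n)
      have "(\<Sum>j<Suc n. ?H (R (2*j + p))) \<le> ?H (\<Union>j<n. R (2*j + p)) + ?H (R (2*n + p))"
        using Suc by (simp add: add_right_mono)
      also have "\<dots> \<le> ?H ((\<Union>j<n. R (2*j + p)) \<union> R (2*n + p))"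
      proof (cases n)
        case (Suc m)
        show ?thesis
        proof (rule hausdorff_outer_infdist_separated)
          show "r (2*n + p) < r (2*m + p + 1)" using Suc by (intro r_less) simp
          show "r (2*m + p + 1) \<le> infdist x C" if "x \<in> (\<Union>j<n. R (2*j + p))" for x
          proof -
            from that obtain j where j: "j < n" "x \<in> R (2*j + p)" by blast
            have "r (2*m + p + 1) \<le> r (Suc (2*j + p))" using j Suc by (intro r_le) simp
            then show ?thesis using j(2) by (auto simp: R_def)
          qed
          show "infdist y C \<le> r (2*n + p)" if "y \<in> R (2*n + p)" for y
            using that by (simp add: R_def)
        qed
      qed simp
      also have "(\<Union>j<n. R (2*j + p)) \<union> R (2*n + p) = (\<Union>j<Suc n. R (2*j + p))"
        by (auto simp: lessThan_Suc)
      finally show ?case .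
    qed simp
    have alt': "(\<Sum>j<n. ?H (R (2*j + p))) \<le> ?H A" for n p
      using alt by (rule order_trans) (auto intro!: hausdorff_outer_mono simp: R_def)
    have two: "(\<Sum>j<2*n. ?H (R j)) = (\<Sum>j<n. ?H (R (2*j + 0))) + (\<Sum>j<n. ?H (R (2*j + 1)))" for n
      by (induction n) (auto simp: algebra_simps)
    have part: "(\<Sum>j<n. ?H (R j)) \<le> ?H A + ?H A" for n
    proof -
      have "(\<Sum>j<n. ?H (R j)) \<le> (\<Sum>j<2*n. ?H (R j))" by (intro sum_mono2) auto
      also have "\<dots> \<le> ?H A + ?H A" unfolding two by (intro add_mono alt')
      finally show ?thesis .
    qed
    define T where "T = (\<Sum>j. ?H (R j))"
    have "T \<le> ?H A + ?H A"
      unfolding T_def by (intro suminf_le_const part) auto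
    then have Tfin: "T \<noteq> top" using fin by (auto simp: top_unique)
    have main: "(?H (A \<inter> C) + ?H (A - C)) + (\<Sum>j<n. ?H (R j)) \<le> ?H A + T" for n
    proof -
      have "A - C \<subseteq> S n \<union> (\<Union>j. R (j + n))"
      proof
        fix x assume x: "x \<in> A - C"
        then have pos: "0 < infdist x C"
          using \<open>closed C\<close> \<open>C \<noteq> {}\<close> in_closed_iff_infdist_zero[of C x] infdist_nonneg[of x C]
          by auto
        have ex: "\<exists>m. r m \<le> infdist x C"
          using reals_Archimedean[OF pos] by (auto simp: r_def intro: less_imp_le)
        define m where "m = (LEAST m. r m \<le> infdist x C)"
        have m: "r m \<le> infdist x C" unfolding m_def by (rule LeastI_ex[OF ex])
        show "x \<in> S n \<union> (\<Union>j. R (j + n))"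
        proof (cases "m \<le> n")
          case True
          then show ?thesis using x m r_le[OF True] by (auto simp: S_def)
        next
          case False
          then obtain k where k: "m = Suc k" "n \<le> k" by (cases m) auto
          have "\<not> r k \<le> infdist x C" using k(1) unfolding m_def by (intro not_less_Least) simp
          then have "x \<in> R k" using x m k by (auto simp: R_def)
          then have "x \<in> R ((k - n) + n)" using k by simp
          then show ?thesis by blast
        qed
      qed
      then have "?H (A - C) \<le> ?H (S n \<union> (\<Union>j. R (j + n)))" by (rule hausdorff_outer_mono)
      also have "\<dots> \<le> ?H (S n) + ?H (\<Union>j. R (j + n))" by (rule hausdorff_outer_Un)
      also have "\<dots> \<le> ?H (S n) + (\<Sum>j. ?H (R (j + n)))"
        by (intro add_left_mono hausdorff_outer_Union)
      finally have "(?H (A \<inter> C) + ?H (A - C)) + (\<Sum>j<n. ?H (R j))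
          \<le> (?H (S n) + ?H (A \<inter> C)) + ((\<Sum>j. ?H (R (j + n))) + (\<Sum>j<n. ?H (R j)))"
        by (auto simp: ac_simps intro!: add_left_mono)
      also have "(\<Sum>j. ?H (R (j + n))) + (\<Sum>j<n. ?H (R j)) = T"
        unfolding T_def by (rule suminf_offset[symmetric]) auto
      also have "?H (S n) + ?H (A \<inter> C) \<le> ?H (S n \<union> (A \<inter> C))"
        by (rule hausdorff_outer_infdist_separated[of 0 "r n" _ C])
           (auto simp: S_def r_def)
      also have "\<dots> \<le> ?H A" by (intro hausdorff_outer_mono) (auto simp: S_def)
      finally show ?thesis by (simp add: add_right_mono)
    qed
    have "(\<lambda>n. \<Sum>j<n. ?H (R j)) \<longlonglongrightarrow> T"
      unfolding T_def by (intro summable_LIMSEQ) auto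
    then have "(\<lambda>n. (?H (A \<inter> C) + ?H (A - C)) + (\<Sum>j<n. ?H (R j)))
        \<longlonglongrightarrow> (?H (A \<inter> C) + ?H (A - C)) + T"
      by (intro tendsto_add tendsto_const)
    then have "(?H (A \<inter> C) + ?H (A - C)) + T \<le> ?H A + T"
      by (rule LIMSEQ_le_const2) (use main in blast)
    then show ?thesis
      using Tfin by (simp add: add.commute[of _ T] ennreal_add_left_cancel_le)
  qed
qed

lemma measure_space_hausdorff:
  "measure_space UNIV (sets (borel :: 'a::metric_space measure)) (hausdorff_outer s)"
proof -
  interpret P: sigma_algebra "UNIV :: 'a set" UNIV
    using sigma_algebra_Pow[of "UNIV :: 'a set"] by simp
  let ?L = "lambda_system UNIV UNIV (hausdorff_outer s) :: 'a set set"
  have L: "measure_space UNIV ?L (hausdorff_outer s)"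
    by (rule P.caratheodory_lemma[OF outer_measure_space_hausdorff])
  then interpret L: sigma_algebra UNIV ?L by (simp add: measure_space_def)
  have "Collect closed \<subseteq> ?L"
    by (auto simp: P.lambda_system_eq hausdorff_outer_closed_split)
  then have "sigma_sets UNIV (Collect closed) \<subseteq> ?L" by (rule L.sigma_sets_subset)
  then have "sets (borel :: 'a measure) \<subseteq> ?L" by (simp add: borel_eq_closed)
  moreover have "sigma_algebra UNIV (sets (borel :: 'a measure))"
    by (metis sets.sigma_algebra_axioms space_borel)
  ultimately show ?thesis
    by (intro measure_down[OF L])
qed

lemma emeasure_hausdorff_measure:
  "A \<in> sets borel \<Longrightarrow> emeasure (hausdorff_measure s) A = hausdorff_outer s A"
  using measure_space_hausdorff[of s, where 'a='a]
  unfolding measure_space_def hausdorff_measure_def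
  by (intro emeasure_measure_of_sigma) auto


section \<open>Cell and boundary integrals, optimal interior weight\<close>

definition surface_measure :: "(real ^ 'n::finite) measure" where
  "surface_measure = hausdorff_measure (CARD('n) - 1)"

definition cell_integral :: "(real ^ 'n::finite) set \<Rightarrow> (real ^ 'n \<Rightarrow> real) \<Rightarrow> real" where
  "cell_integral K U = (LINT x:K|lborel. U x)"

definition boundary_integral :: "(real ^ 'n::finite) set \<Rightarrow> (real ^ 'n \<Rightarrow> real) \<Rightarrow> real" where
  "boundary_integral K U = (LINT x:frontier K|surface_measure. U x)"

definition mesh_cell :: "(real ^ 'n::finite) set \<Rightarrow> bool" where
  "mesh_cell K \<longleftrightarrow> compact K \<and> interior K \<noteq> {} \<and>
     0 < emeasure surface_measure (frontier K) \<and> emeasure surface_measure (frontier K) < \<infinity>"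

definition positive_cone ::
  "(real ^ 'n::finite \<Rightarrow> real) set \<Rightarrow> (real ^ 'n) set \<Rightarrow> (real ^ 'n \<Rightarrow> real) set" where
  "positive_cone V K = {U\<in>V. (\<forall>x\<in>K. 0 \<le> U x) \<and> 0 < cell_integral K U}"

text \<open>The supremum is taken in the extended reals, so that an unbounded ratio would give \<open>\<infinity>\<close>.\<close>

definition optimal_interior_weight ::
  "(real ^ 'n::finite \<Rightarrow> real) set \<Rightarrow> (real ^ 'n) set \<Rightarrow> ereal" where
  "optimal_interior_weight V K =
     (SUP U\<in>positive_cone V K. ereal (boundary_integral K U / cell_integral K U))"

end

theory Submission
  imports Defs
begin

text \<open>
  Let \<open>C\<close> and \<open>B\<close> be the cell and boundary integrals on \<open>V\<close>, and let \<open>P\<close> be the cone of those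
  \<open>U \<in> V\<close> that are nonnegative on \<open>K\<close>. Quadrature rules with nonnegative weights and nodes in \<open>K\<close>
  form the cone generated by the point evaluations \<open>U \<mapsto> U x\<close>, \<open>x \<in> K\<close>, and the theorem comes from
  the duality between this cone and \<open>P\<close>: a linear functional on \<open>V\<close> that is nonnegative on \<open>P\<close> is
  such a quadrature rule (\<open>moment_cone_dual\<close>). This duality needs the cone of quadrature
  rules to be closed. It is, because Caratheodory's theorem bounds the number of nodes by
  \<open>dim V\<close>, the nodes range over a compact set, and the constant \<open>1 \<in> V\<close> controls the total weight.
  The optimal functional lies on the boundary of the cone, so separation from the closure alone would not suffice.

  The supremum \<open>M\<close> of \<open>B U / C U\<close> is finite. A polynomial that is nonnegative on \<open>K\<close> and has
  \<open>C U = 0\<close> vanishes on the nonempty interior of \<open>K\<close> and hence everywhere, so \<open>C\<close> is strictly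
  positive on \<open>P - {0}\<close>, and on a finite-dimensional space such a functional dominates every other
  linear functional on \<open>P\<close> (\<open>positive_functional_dominates\<close>). Testing with the constant 1 gives
  \<open>M > 0\<close>. By the choice of \<open>M\<close>, the functional \<open>C - B / M\<close> is nonnegative on \<open>P\<close>. Duality turns
  it into a quadrature rule, and the weight on the boundary integral is \<open>1 / M\<close>.
\<close>


section \<open>The cone generated by point evaluations\<close>

text \<open>
  Gaussian elimination of one equation at a time. It is the linear dependence behind Caratheodory's
  reduction below.
\<close>

lemma homogeneous_system_nontrivial:
  fixes b :: "'i \<Rightarrow> 'a \<Rightarrow> real"
  assumes "finite I" "finite X" "card I < card X"
  shows "\<exists>\<mu>. (\<exists>x\<in>X. \<mu> x \<noteq> 0) \<and> (\<forall>i\<in>I. (\<Sum>x\<in>X. \<mu> x * b i x) = 0)"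
  using assms
proof (induction I arbitrary: X b rule: finite_induct)
  case empty
  then obtain x where "x \<in> X" by (metis card.empty card_gt_0_iff ex_in_conv)
  then show ?case by (intro exI[of _ "\<lambda>_. 1"]) auto
next
  case (insert k I)
  show ?case
  proof (cases "\<forall>x\<in>X. b k x = 0")
    case True
    obtain \<mu> where "\<exists>x\<in>X. \<mu> x \<noteq> 0" "\<forall>i\<in>I. (\<Sum>x\<in>X. \<mu> x * b i x) = 0"
      using insert.IH[of X b] insert.hyps insert.prems by auto
    then show ?thesis using True by (intro exI[of _ \<mu>]) auto
  next
    case False
    then obtain z where z: "z \<in> X" "b k z \<noteq> 0" by blast
    let ?Y = "X - {z}"
    \<comment> \<open>Use equation \<open>k\<close> to eliminate the unknown at \<open>z\<close> from all other equations.\<close>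
    define b' where "b' i x = b i x - b i z / b k z * b k x" for i x
    have "card I < card ?Y" using insert z by (simp add: card_Diff_singleton)
    then obtain \<mu> where \<mu>: "\<exists>x\<in>?Y. \<mu> x \<noteq> 0" "\<forall>i\<in>I. (\<Sum>x\<in>?Y. \<mu> x * b' i x) = 0"
      using insert.IH[of ?Y b'] insert.prems by auto
    define s where "s = (\<Sum>x\<in>?Y. \<mu> x * b k x)"
    define \<nu> where "\<nu> = \<mu>(z := - s / b k z)"
    have split: "(\<Sum>x\<in>X. \<nu> x * b i x) = (\<Sum>x\<in>?Y. \<mu> x * b i x) - s / b k z * b i z" for i
      using insert.prems z by (simp add: sum.remove[of X z] \<nu>_def)
    have "(\<Sum>x\<in>X. \<nu> x * b i x) = 0" if "i \<in> I" for i
    proof -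
      have "(\<Sum>x\<in>?Y. \<mu> x * b' i x) = (\<Sum>x\<in>?Y. \<mu> x * b i x) - b i z / b k z * s"
        by (simp add: b'_def s_def algebra_simps sum_subtractf sum_distrib_left)
      with \<mu>(2) that show ?thesis by (simp add: split)
    qed
    moreover have "(\<Sum>x\<in>X. \<nu> x * b k x) = 0"
      using z by (simp add: split s_def)
    moreover have "\<exists>x\<in>X. \<nu> x \<noteq> 0" using \<mu>(1) by (auto simp: \<nu>_def)
    ultimately show ?thesis by blast
  qed
qed

text \<open>
  A functional on the span of the functions \<open>b i\<close>, \<open>i \<in> I\<close>, is represented by its values on them.
  Only the coordinates in \<open>I\<close> of a member are constrained; the others are arbitrary.
\<close>

definition moment_cone :: "'i set \<Rightarrow> ('i \<Rightarrow> 'a \<Rightarrow> real) \<Rightarrow> 'a set \<Rightarrow> ('i \<Rightarrow> real) set" where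
  "moment_cone I b K = {p. \<exists>X w. finite X \<and> X \<subseteq> K \<and> (\<forall>x\<in>X. 0 \<le> w x) \<and>
     (\<forall>i\<in>I. p i = (\<Sum>x\<in>X. w x * b i x))}"

lemma moment_coneI:
  "finite X \<Longrightarrow> X \<subseteq> K \<Longrightarrow> (\<And>x. x \<in> X \<Longrightarrow> 0 \<le> w x) \<Longrightarrow>
   (\<And>i. i \<in> I \<Longrightarrow> p i = (\<Sum>x\<in>X. w x * b i x)) \<Longrightarrow> p \<in> moment_cone I b K"
  unfolding moment_cone_def by blast

lemma zero_in_moment_cone: "(\<lambda>i. 0) \<in> moment_cone I b K"
  by (rule moment_coneI[of "{}"]) auto

lemma point_in_moment_cone: "x \<in> K \<Longrightarrow> 0 \<le> t \<Longrightarrow> (\<lambda>i. t * b i x) \<in> moment_cone I b K"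
  by (rule moment_coneI[of "{x}" _ "\<lambda>_. t"]) auto

lemma scale_in_moment_cone:
  assumes "p \<in> moment_cone I b K" "0 \<le> t"
  shows "(\<lambda>i. t * p i) \<in> moment_cone I b K"
proof -
  from assms(1) obtain X w where "finite X" "X \<subseteq> K" "\<forall>x\<in>X. 0 \<le> w x"
    "\<forall>i\<in>I. p i = (\<Sum>x\<in>X. w x * b i x)" by (auto simp: moment_cone_def)
  then show ?thesis
    using assms(2)
    by (intro moment_coneI[of X _ "\<lambda>x. t * w x"]) (auto simp: sum_distrib_left mult.assoc)
qed

lemma add_in_moment_cone:
  assumes "p \<in> moment_cone I b K" "q \<in> moment_cone I b K"
  shows "(\<lambda>i. p i + q i) \<in> moment_cone I b K"
proof -
  from assms(1) obtain X w where X: "finite X" "X \<subseteq> K" "\<forall>x\<in>X. 0 \<le> w x"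
    "\<forall>i\<in>I. p i = (\<Sum>x\<in>X. w x * b i x)" by (auto simp: moment_cone_def)
  from assms(2) obtain Y u where Y: "finite Y" "Y \<subseteq> K" "\<forall>x\<in>Y. 0 \<le> u x"
    "\<forall>i\<in>I. q i = (\<Sum>x\<in>Y. u x * b i x)" by (auto simp: moment_cone_def)
  define v where "v x = (if x \<in> X then w x else 0) + (if x \<in> Y then u x else 0)" for x
  have "(\<Sum>x\<in>X. w x * b i x) = (\<Sum>x\<in>X \<union> Y. (if x \<in> X then w x else 0) * b i x)" for i
    using X(1) Y(1) by (intro sum.mono_neutral_cong_left) auto
  moreover have "(\<Sum>x\<in>Y. u x * b i x) = (\<Sum>x\<in>X \<union> Y. (if x \<in> Y then u x else 0) * b i x)" for i
    using X(1) Y(1) by (intro sum.mono_neutral_cong_left) auto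
  ultimately show ?thesis
    using X Y by (intro moment_coneI[of "X \<union> Y" _ v])
      (auto simp: v_def sum.distrib[symmetric] distrib_right)
qed

lemma sum_in_moment_cone:
  assumes "\<And>j. j \<in> J \<Longrightarrow> 0 \<le> w j" "\<And>j. j \<in> J \<Longrightarrow> x j \<in> K"
  shows "(\<lambda>i. \<Sum>j\<in>J. w j * b i (x j)) \<in> moment_cone I b K"
  using assms
proof (induction J rule: infinite_finite_induct)
  case (insert j J)
  then show ?case
    using add_in_moment_cone[OF point_in_moment_cone[of "x j" K "w j" b I] insert.IH] by simp
qed (simp_all add: zero_in_moment_cone)

text \<open>
  As long as there are more than \<open>card I\<close> nodes, some nontrivial \<open>\<mu>\<close> has vanishing moments.
  Subtracting the largest multiple of \<open>\<mu>\<close> that keeps the weights nonnegative removes a node.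
\<close>

lemma conic_caratheodory:
  fixes b :: "'i \<Rightarrow> 'a \<Rightarrow> real"
  assumes "finite I" "finite X" "\<forall>x\<in>X. 0 \<le> w x"
  shows "\<exists>Y u. Y \<subseteq> X \<and> card Y \<le> card I \<and> (\<forall>x\<in>Y. 0 \<le> u x) \<and>
           (\<forall>i\<in>I. (\<Sum>x\<in>X. w x * b i x) = (\<Sum>x\<in>Y. u x * b i x))"
  using assms(2,3)
proof (induction "card X" arbitrary: X w rule: less_induct)
  case less
  show ?case
  proof (cases "card X \<le> card I")
    case True
    then show ?thesis using less.prems by blast
  next
    case False
    then obtain \<mu>' where \<mu>': "\<exists>x\<in>X. \<mu>' x \<noteq> 0" "\<forall>i\<in>I. (\<Sum>x\<in>X. \<mu>' x * b i x) = 0"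
      using homogeneous_system_nontrivial[OF assms(1) less.prems(1), of b] by auto
    then obtain \<mu> where \<mu>: "\<exists>x\<in>X. 0 < \<mu> x" "\<forall>i\<in>I. (\<Sum>x\<in>X. \<mu> x * b i x) = 0"
    proof (cases "\<exists>x\<in>X. 0 < \<mu>' x")
      case False
      with \<mu>' that[of "\<lambda>x. - \<mu>' x"] show thesis by (force simp: sum_negf)
    qed (use \<mu>' that in blast)
    let ?Q = "{x\<in>X. 0 < \<mu> x}"
    have Q: "finite ?Q" "?Q \<noteq> {}" using \<mu> less.prems by auto
    define t where "t = Min ((\<lambda>x. w x / \<mu> x) ` ?Q)"
    have "t \<in> (\<lambda>x. w x / \<mu> x) ` ?Q" unfolding t_def using Q by (intro Min_in) auto
    then obtain z where z: "z \<in> X" "0 < \<mu> z" "t = w z / \<mu> z" by auto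
    have t0: "0 \<le> t" using z less.prems by auto
    define w' where "w' x = w x - t * \<mu> x" for x
    have w'0: "w' z = 0" using z by (simp add: w'_def)
    have w': "0 \<le> w' x" if "x \<in> X" for x
    proof (cases "0 < \<mu> x")
      case True
      then have "t \<le> w x / \<mu> x" unfolding t_def using Q(1) that by (intro Min_le) auto
      then show ?thesis using True by (simp add: w'_def field_simps)
    next
      case False
      then have "t * \<mu> x \<le> 0" using t0 by (simp add: mult_nonneg_nonpos)
      then show ?thesis using less.prems(2) that by (force simp: w'_def)
    qed
    have eq: "(\<Sum>x\<in>X. w x * b i x) = (\<Sum>x\<in>X - {z}. w' x * b i x)" if "i \<in> I" for i
    proof -
      have "(\<Sum>x\<in>X. w' x * b i x) = (\<Sum>x\<in>X. w x * b i x) - t * (\<Sum>x\<in>X. \<mu> x * b i x)"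
        by (simp add: w'_def algebra_simps sum_subtractf sum_distrib_left)
      then show ?thesis
        using \<mu>(2) that z w'0 less.prems(1) by (simp add: sum.remove[of X z])
    qed
    have "card (X - {z}) < card X" using less.prems(1) z(1) by (rule card_Diff1_less)
    from less.hyps[OF this, of w'] less.prems(1) w'
    obtain Y u where "Y \<subseteq> X - {z}" "card Y \<le> card I" "\<forall>x\<in>Y. 0 \<le> u x"
      "\<forall>i\<in>I. (\<Sum>x\<in>X - {z}. w' x * b i x) = (\<Sum>x\<in>Y. u x * b i x)" by auto
    then show ?thesis using eq by (intro exI[of _ Y] exI[of _ u]) auto
  qed
qed

lemma compact_functions:
  fixes S :: "'b::topological_space set"
  assumes "compact S"
  shows "compact {f :: 'a \<Rightarrow> 'b. \<forall>j. f j \<in> S}"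
proof -
  have "{f :: 'a \<Rightarrow> 'b. \<forall>j. f j \<in> S} = PiE UNIV (\<lambda>_. S)" by auto
  moreover have "compactin (product_topology (\<lambda>_. euclidean) UNIV) (PiE UNIV (\<lambda>_::'a. S))"
    using assms by (simp add: compactin_PiE)
  ultimately show ?thesis by (simp add: euclidean_product_topology)
qed

text \<open>
  This is where closedness of the cone enters. With \<open>card I\<close> nodes, the cone is the image of
  a space of weights and nodes that is compact apart from the unboundedness of the weights. The
  assumption that \<open>1\<close> lies in the span of the \<open>b i\<close> expresses the total weight through the moments,
  which are bounded on candidates no farther from \<open>l\<close> than the origin.
\<close>

lemma moment_cone_nearest_point:
  fixes b :: "'i \<Rightarrow> 'a::topological_space \<Rightarrow> real" and l :: "'i \<Rightarrow> real"
  assumes I: "finite I" and K: "compact K" "K \<noteq> {}"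
    and cont: "\<And>i. i \<in> I \<Longrightarrow> continuous_on K (b i)"
    and one: "\<And>x. x \<in> K \<Longrightarrow> (\<Sum>i\<in>I. c i * b i x) = 1"
  shows "\<exists>p\<in>moment_cone I b K. \<forall>q\<in>moment_cone I b K.
           (\<Sum>i\<in>I. (p i - l i)\<^sup>2) \<le> (\<Sum>i\<in>I. (q i - l i)\<^sup>2)"
proof -
  define F where "F p = (\<Sum>i\<in>I. (p i - l i)\<^sup>2)" for p
  define N where "N = card I"
  \<comment> \<open>A bound on the total weight of every cone element at least as close to \<open>l\<close> as the origin.\<close>
  define R where "R = (\<Sum>i\<in>I. \<bar>c i\<bar> * (\<bar>l i\<bar> + sqrt (F (\<lambda>_. 0))))"
  define S where "S = {w :: nat \<Rightarrow> real. \<forall>j. w j \<in> {0..R}} \<times> {x :: nat \<Rightarrow> 'a. \<forall>j. x j \<in> K}"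
  define m where "m = (\<lambda>(w, x) i. \<Sum>j<N. w j * b i (x j))"
  have F0: "0 \<le> F p" for p unfolding F_def by (intro sum_nonneg) auto
  have R0: "0 \<le> R" unfolding R_def using F0 by (intro sum_nonneg) auto
  obtain x0 where x0: "x0 \<in> K" using K by blast
  have "compact S" unfolding S_def
    by (intro compact_Times compact_functions K) auto
  moreover have "S \<noteq> {}" using R0 x0 by (auto simp: S_def intro: exI[of _ "\<lambda>_. 0"] exI[of _ "\<lambda>_. x0"])
  moreover have "continuous_on S (\<lambda>s. F (m s))"
  proof -
    have point: "continuous_on S (\<lambda>s. b i (snd s j))" if "i \<in> I" for i j
      by (rule continuous_on_compose2[OF cont[OF that]])
         (auto simp: S_def intro!: continuous_on_product_then_coordinatewise[OF continuous_on_snd[OF continuous_on_id]])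
    have weight: "continuous_on S (\<lambda>s. fst s j)" for j
      by (rule continuous_on_product_then_coordinatewise[OF continuous_on_fst[OF continuous_on_id]])
    show ?thesis
      unfolding F_def m_def case_prod_unfold
      by (intro continuous_on_sum continuous_on_power continuous_on_diff continuous_on_mult
          continuous_on_const point weight)
  qed
  ultimately obtain s where s: "s \<in> S" and smin: "\<And>s'. s' \<in> S \<Longrightarrow> F (m s) \<le> F (m s')"
    using continuous_attains_inf[of S "\<lambda>s. F (m s)"] by blast
  have "m s \<in> moment_cone I b K"
    using s by (auto simp: m_def S_def intro!: sum_in_moment_cone)
  moreover have "F (m s) \<le> F q" if q: "q \<in> moment_cone I b K" for q
  proof (cases "F q \<le> F (\<lambda>_. 0)")
    case False
    have "F (m s) \<le> F (m (\<lambda>_. 0, \<lambda>_. x0))" using R0 x0 by (intro smin) (auto simp: S_def)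
    then show ?thesis using False by (simp add: m_def)
  next
    case True
    from q obtain X w where X: "finite X" "X \<subseteq> K" "\<forall>x\<in>X. 0 \<le> w x"
      and qX: "\<forall>i\<in>I. q i = (\<Sum>x\<in>X. w x * b i x)" unfolding moment_cone_def by blast
    obtain Y u where YX: "Y \<subseteq> X" and Y: "card Y \<le> N" "\<forall>x\<in>Y. 0 \<le> u x"
      and XY: "\<forall>i\<in>I. (\<Sum>x\<in>X. w x * b i x) = (\<Sum>x\<in>Y. u x * b i x)"
      using conic_caratheodory[OF I X(1,3), of b] unfolding N_def by blast
    have YK: "Y \<subseteq> K" "finite Y" using YX X finite_subset by auto
    have qY: "q i = (\<Sum>x\<in>Y. u x * b i x)" if "i \<in> I" for i using that qX XY by simp
    have uR: "u y \<le> R" if "y \<in> Y" for y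
    proof -
      have "u y \<le> sum u Y" using Y YK that by (intro member_le_sum) auto
      also have "\<dots> = (\<Sum>x\<in>Y. u x * (\<Sum>i\<in>I. c i * b i x))"
        using YK one by (intro sum.cong) auto
      also have "\<dots> = (\<Sum>i\<in>I. c i * q i)"
      proof -
        have "(\<Sum>x\<in>Y. u x * (\<Sum>i\<in>I. c i * b i x)) = (\<Sum>x\<in>Y. \<Sum>i\<in>I. c i * (u x * b i x))"
          by (simp add: sum_distrib_left mult_ac)
        also have "\<dots> = (\<Sum>i\<in>I. \<Sum>x\<in>Y. c i * (u x * b i x))" by (rule sum.swap)
        also have "\<dots> = (\<Sum>i\<in>I. c i * q i)" by (simp add: qY sum_distrib_left)
        finally show ?thesis .
      qed
      also have "\<dots> \<le> R"
        unfolding R_def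
      proof (rule sum_mono)
        fix i assume i: "i \<in> I"
        have "(q i - l i)\<^sup>2 \<le> F q"
          unfolding F_def using I i by (intro member_le_sum[of i I "\<lambda>i. (q i - l i)\<^sup>2"]) auto
        then have "\<bar>q i - l i\<bar> \<le> sqrt (F (\<lambda>_. 0))"
          using True by (intro real_le_rsqrt) simp
        then have "\<bar>q i\<bar> \<le> \<bar>l i\<bar> + sqrt (F (\<lambda>_. 0))" by linarith
        then have "\<bar>c i\<bar> * \<bar>q i\<bar> \<le> \<bar>c i\<bar> * (\<bar>l i\<bar> + sqrt (F (\<lambda>_. 0)))"
          by (intro mult_left_mono) auto
        then show "c i * q i \<le> \<bar>c i\<bar> * (\<bar>l i\<bar> + sqrt (F (\<lambda>_. 0)))"
          by (metis abs_ge_self abs_mult order_trans)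
      qed
      finally show ?thesis .
    qed
    obtain e where e: "bij_betw e {..<card Y} Y"
      using ex_bij_betw_nat_finite[OF YK(2)] by (auto simp: lessThan_atLeast0)
    \<comment> \<open>Pad the at most \<open>N\<close> nodes by zero weights at \<open>x0\<close> to get a point of the compact set.\<close>
    define w' where "w' j = (if j < card Y then u (e j) else 0)" for j
    define x' where "x' j = (if j < card Y then e j else x0)" for j
    have eY: "e j \<in> Y" if "j < card Y" for j using e that by (auto simp: bij_betw_def)
    have "(w', x') \<in> S" using eY Y YK R0 x0 uR by (auto simp: S_def w'_def x'_def)
    moreover have "m (w', x') i = q i" if "i \<in> I" for i
    proof -
      have "m (w', x') i = (\<Sum>j<card Y. u (e j) * b i (e j))"
        unfolding m_def prod.case using Y(1)
        by (intro sum.mono_neutral_cong_right) (auto simp: w'_def x'_def)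
      also have "\<dots> = (\<Sum>x\<in>Y. u x * b i x)" by (rule sum.reindex_bij_betw[OF e])
      finally show ?thesis using qY that by simp
    qed
    ultimately show ?thesis using smin[of "(w', x')"] by (simp add: F_def)
  qed
  ultimately show ?thesis unfolding F_def by blast
qed

lemma nonneg_of_quadratic_nonneg:
  fixes a r :: real
  assumes "\<And>t. 0 < t \<Longrightarrow> t \<le> 1 \<Longrightarrow> 0 \<le> 2 * t * a + t\<^sup>2 * r"
  shows "0 \<le> a"
proof -
  have "0 \<le> 2 * a + t * r" if "0 < t" "t \<le> 1" for t
  proof -
    have "0 \<le> t * (2 * a + t * r)"
      using assms[OF that] by (simp add: algebra_simps power2_eq_square)
    then show ?thesis using that by (simp add: zero_le_mult_iff)
  qed
  then have "eventually (\<lambda>t. 0 \<le> 2 * a + t * r) (at_right 0)"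
    unfolding eventually_at_right_field by (intro exI[of _ 1]) auto
  moreover have "((\<lambda>t. 2 * a + t * r) \<longlongrightarrow> 2 * a + 0 * r) (at_right 0)"
    by (intro tendsto_intros)
  ultimately show ?thesis
    using tendsto_lowerbound[of "\<lambda>t. 2 * a + t * r" "2 * a + 0 * r" "at_right 0" 0] by simp
qed

text \<open>
  Let \<open>p\<close> be the point of the cone nearest to \<open>l\<close> and \<open>d = p - l\<close>. Moving from \<open>p\<close> towards point
  evaluations shows that the function with coefficients \<open>d\<close> is nonnegative on \<open>K\<close>, so
  \<open>\<langle>d, l\<rangle> \<ge> 0\<close>. Moving from \<open>p\<close> towards the origin gives \<open>\<langle>d, p\<rangle> \<le> 0\<close>. Together they force
  \<open>|d|\<^sup>2 = \<langle>d, p\<rangle> - \<langle>d, l\<rangle> \<le> 0\<close>.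
\<close>

theorem moment_cone_dual:
  fixes b :: "'i \<Rightarrow> 'a::topological_space \<Rightarrow> real" and l :: "'i \<Rightarrow> real"
  assumes I: "finite I" and K: "compact K" "K \<noteq> {}"
    and cont: "\<And>i. i \<in> I \<Longrightarrow> continuous_on K (b i)"
    and one: "\<And>x. x \<in> K \<Longrightarrow> (\<Sum>i\<in>I. c i * b i x) = 1"
    and pos: "\<And>d. \<forall>x\<in>K. 0 \<le> (\<Sum>i\<in>I. d i * b i x) \<Longrightarrow> 0 \<le> (\<Sum>i\<in>I. d i * l i)"
  shows "l \<in> moment_cone I b K"
proof -
  obtain p where p: "p \<in> moment_cone I b K"
    and pmin: "\<And>q. q \<in> moment_cone I b K \<Longrightarrow>
      (\<Sum>i\<in>I. (p i - l i)\<^sup>2) \<le> (\<Sum>i\<in>I. (q i - l i)\<^sup>2)"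
    using moment_cone_nearest_point[OF I K cont one, where l = l] by blast
  define d where "d i = p i - l i" for i
  have variation: "0 \<le> (\<Sum>i\<in>I. d i * v i)"
    if v: "\<And>t. 0 < t \<Longrightarrow> t \<le> 1 \<Longrightarrow> (\<lambda>i. p i + t * v i) \<in> moment_cone I b K" for v
  proof (rule nonneg_of_quadratic_nonneg)
    fix t :: real assume "0 < t" "t \<le> 1"
    from pmin[OF v[OF this]]
    have "0 \<le> (\<Sum>i\<in>I. (p i + t * v i - l i)\<^sup>2 - (p i - l i)\<^sup>2)" by (simp add: sum_subtractf)
    also have "\<dots> = (\<Sum>i\<in>I. 2 * t * (d i * v i) + t\<^sup>2 * (v i)\<^sup>2)"
      by (intro sum.cong) (auto simp: d_def power2_eq_square algebra_simps)
    finally show "0 \<le> 2 * t * (\<Sum>i\<in>I. d i * v i) + t\<^sup>2 * (\<Sum>i\<in>I. (v i)\<^sup>2)"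
      by (simp add: sum.distrib sum_distrib_left)
  qed
  have "0 \<le> (\<Sum>i\<in>I. d i * b i x)" if "x \<in> K" for x
  proof (rule variation)
    fix t :: real assume "0 < t"
    then show "(\<lambda>i. p i + t * b i x) \<in> moment_cone I b K"
      using that by (intro add_in_moment_cone[OF p] point_in_moment_cone) auto
  qed
  then have "0 \<le> (\<Sum>i\<in>I. d i * l i)" by (intro pos) auto
  moreover have "0 \<le> (\<Sum>i\<in>I. d i * - p i)"
  proof (rule variation)
    fix t :: real assume "t \<le> 1"
    then have "(\<lambda>i. (1 - t) * p i) \<in> moment_cone I b K" by (intro scale_in_moment_cone[OF p]) auto
    then show "(\<lambda>i. p i + t * - p i) \<in> moment_cone I b K" by (simp add: algebra_simps)
  qed
  moreover have "(\<Sum>i\<in>I. (d i)\<^sup>2) = - (\<Sum>i\<in>I. d i * l i) - (\<Sum>i\<in>I. d i * - p i)"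
    by (simp add: d_def power2_eq_square algebra_simps sum_subtractf sum_negf sum.distrib sum_distrib_left)
  ultimately have "(\<Sum>i\<in>I. (d i)\<^sup>2) \<le> 0" by linarith
  then have "\<forall>i\<in>I. (d i)\<^sup>2 = 0"
    using sum_nonneg_eq_0_iff[OF I, of "\<lambda>i. (d i)\<^sup>2"] sum_nonneg[of I "\<lambda>i. (d i)\<^sup>2"] by auto
  then have "\<forall>i\<in>I. l i = p i" by (simp add: d_def)
  with p show ?thesis by (simp add: moment_cone_def)
qed

section \<open>Strictly positive functionals\<close>

text \<open>
  The coefficient vectors of Euclidean norm 1 whose combination is nonnegative on \<open>K\<close> form a compact
  set, on which \<open>\<gamma>\<close> has a positive minimum and \<open>\<beta>\<close> is bounded. Scaling does the rest.
\<close>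

lemma positive_functional_dominates:
  fixes b :: "'i \<Rightarrow> 'a \<Rightarrow> real" and \<beta> \<gamma> :: "'i \<Rightarrow> real"
  assumes I: "finite I"
    and pos: "\<And>c. \<forall>x\<in>K. 0 \<le> (\<Sum>i\<in>I. c i * b i x) \<Longrightarrow> \<exists>i\<in>I. c i \<noteq> 0 \<Longrightarrow>
      0 < (\<Sum>i\<in>I. c i * \<gamma> i)"
  shows "\<exists>M. \<forall>c. (\<forall>x\<in>K. 0 \<le> (\<Sum>i\<in>I. c i * b i x)) \<longrightarrow>
           (\<Sum>i\<in>I. c i * \<beta> i) \<le> M * (\<Sum>i\<in>I. c i * \<gamma> i)"
proof -
  \<comment> \<open>The box confines also the coordinates outside \<open>I\<close>, which makes the set compact as a set of
    functions on the whole index type.\<close>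
  define S where "S = {c. \<forall>i. c i \<in> {-1..1::real}} \<inter>
    ({c. (\<Sum>i\<in>I. (c i)\<^sup>2) = 1} \<inter> (\<Inter>x\<in>K. {c. 0 \<le> (\<Sum>i\<in>I. c i * b i x)}))"
  have coord: "continuous_on UNIV (\<lambda>c :: 'i \<Rightarrow> real. c i)" for i by simp
  have "compact S" unfolding S_def
    by (intro compact_Int_closed compact_functions closed_Int closed_INT ballI closed_Collect_eq
        closed_Collect_le continuous_intros coord) auto
  have "\<exists>\<delta>>0. \<forall>c\<in>S. \<delta> \<le> (\<Sum>i\<in>I. c i * \<gamma> i)"
  proof (cases "S = {}")
    case False
    have "continuous_on S (\<lambda>c. \<Sum>i\<in>I. c i * \<gamma> i)"
      by (intro continuous_intros continuous_on_subset[OF coord]) auto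
    then obtain c where c: "c \<in> S" "\<forall>c'\<in>S. (\<Sum>i\<in>I. c i * \<gamma> i) \<le> (\<Sum>i\<in>I. c' i * \<gamma> i)"
      using continuous_attains_inf[OF \<open>compact S\<close> False] by blast
    have "\<exists>i\<in>I. c i \<noteq> 0"
    proof (rule ccontr)
      assume "\<not> ?thesis"
      then have "(\<Sum>i\<in>I. (c i)\<^sup>2) = 0" by simp
      then show False using c(1) by (simp add: S_def)
    qed
    then have "0 < (\<Sum>i\<in>I. c i * \<gamma> i)" using c(1) by (intro pos) (auto simp: S_def)
    then show ?thesis using c(2) by blast
  qed (auto intro: exI[of _ 1])
  then obtain \<delta> where \<delta>: "0 < \<delta>" "\<And>c. c \<in> S \<Longrightarrow> \<delta> \<le> (\<Sum>i\<in>I. c i * \<gamma> i)" by blast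
  define M where "M = (\<Sum>i\<in>I. \<bar>\<beta> i\<bar>) / \<delta>"
  have M0: "0 \<le> M" using \<delta> by (simp add: M_def sum_nonneg)
  have "(\<Sum>i\<in>I. c i * \<beta> i) \<le> M * (\<Sum>i\<in>I. c i * \<gamma> i)"
    if c: "\<forall>x\<in>K. 0 \<le> (\<Sum>i\<in>I. c i * b i x)" for c
  proof (cases "\<exists>i\<in>I. c i \<noteq> 0")
    case True
    define s where "s = sqrt (\<Sum>i\<in>I. (c i)\<^sup>2)"
    have "0 < (\<Sum>i\<in>I. (c i)\<^sup>2)"
      using True I by (auto intro: sum_pos2)
    then have s: "0 < s" "s\<^sup>2 = (\<Sum>i\<in>I. (c i)\<^sup>2)" by (auto simp: s_def)
    have le_s: "\<bar>c i\<bar> \<le> s" if "i \<in> I" for i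
      unfolding s_def using I that
      by (intro real_le_rsqrt) (auto intro: member_le_sum[of i I "\<lambda>i. (c i)\<^sup>2"])
    define c' where "c' i = (if i \<in> I then c i / s else 0)" for i
    have scaled: "(\<Sum>i\<in>I. c' i * f i) = (\<Sum>i\<in>I. c i * f i) / s" for f
      by (simp add: c'_def sum_divide_distrib)
    have box: "\<bar>c' i\<bar> \<le> 1" for i using le_s[of i] s by (simp add: c'_def)
    have "(\<Sum>i\<in>I. (c' i)\<^sup>2) = 1"
      using s(1) by (simp add: c'_def power_divide sum_divide_distrib[symmetric] s(2)[symmetric])
    then have "c' \<in> S" using box c s by (auto simp: S_def scaled abs_le_iff minus_le_iff)
    have "(\<Sum>i\<in>I. c' i * \<beta> i) \<le> (\<Sum>i\<in>I. \<bar>\<beta> i\<bar>)"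
    proof (rule sum_mono)
      fix i
      have "c' i * \<beta> i \<le> \<bar>c' i\<bar> * \<bar>\<beta> i\<bar>" by (metis abs_ge_self abs_mult)
      also have "\<dots> \<le> 1 * \<bar>\<beta> i\<bar>" using box by (intro mult_right_mono) auto
      finally show "c' i * \<beta> i \<le> \<bar>\<beta> i\<bar>" by simp
    qed
    also have "\<dots> = M * \<delta>" using \<delta> by (simp add: M_def)
    also have "\<dots> \<le> M * (\<Sum>i\<in>I. c' i * \<gamma> i)" using \<delta>(2)[OF \<open>c' \<in> S\<close>] M0 by (rule mult_left_mono)
    finally show ?thesis using s(1) by (simp add: scaled divide_le_cancel)
  qed simp
  then show ?thesis by blast
qed

section \<open>Polynomials and their cell and boundary integrals\<close>

text \<open>
  On the line through a point of \<open>S\<close> and an arbitrary point, the polynomial becomes a univariate one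
  that vanishes on a neighbourhood of 0, so it has infinitely many roots.
\<close>

lemma polynomial_zero_on_open:
  fixes U :: "'a::euclidean_space \<Rightarrow> real"
  assumes U: "real_polynomial_function U" and S: "open S" "S \<noteq> {}"
    and zero: "\<And>x. x \<in> S \<Longrightarrow> U x = 0"
  shows "U x = 0"
proof -
  obtain a where a: "a \<in> S" using S by blast
  define g where "g t = a + t *\<^sub>R (x - a)" for t :: real
  have "polynomial_function g" unfolding g_def
    by (intro polynomial_function_add polynomial_function_const polynomial_function_mult
        polynomial_function_id[unfolded id_def])
  then have "real_polynomial_function (U \<circ> g)" using U by (rule real_polynomial_function_compose)
  then obtain c n where cn: "U \<circ> g = (\<lambda>t. \<Sum>i\<le>n. c i * t ^ i)"
    using real_polynomial_function_iff_sum by blast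
  have "open (g -` S)"
    using S(1) unfolding g_def by (intro open_vimage continuous_intros)
  moreover have "0 \<in> g -` S" using a by (simp add: g_def)
  ultimately have "infinite (g -` S)" by (metis empty_iff finite_imp_not_open)
  moreover have "g -` S \<subseteq> {t. (\<Sum>i\<le>n. c i * t ^ i) = 0}"
    using zero fun_cong[OF cn, symmetric] by auto
  ultimately have "infinite {t. (\<Sum>i\<le>n. c i * t ^ i) = 0}" using finite_subset by blast
  then have "\<forall>i\<le>n. c i = 0" using polyfun_finite_roots by blast
  then have "(U \<circ> g) 1 = 0" by (simp add: cn)
  then show ?thesis by (simp add: g_def)
qed

lemma polynomial_continuous_on:
  "real_polynomial_function U \<Longrightarrow> continuous_on A U"
  by (simp add: continuous_at_imp_continuous_on continuous_real_polymonial_function)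

lemma cell_set_integrable:
  fixes U :: "'a::euclidean_space \<Rightarrow> real"
  assumes "compact K" "continuous_on K U"
  shows "set_integrable lborel K U"
  using borel_integrable_compact[OF assms] by (simp add: set_integrable_def)

lemma boundary_set_integrable:
  fixes U :: "real ^ 'n::finite \<Rightarrow> real"
  assumes K: "mesh_cell K" and U: "continuous_on UNIV U"
  shows "set_integrable surface_measure (frontier K) U"
proof -
  have cpt: "compact (frontier K)"
    using K by (simp add: mesh_cell_def compact_frontier)
  have sets: "sets surface_measure = sets (borel :: (real ^ 'n) measure)"
    by (simp add: surface_measure_def)
  have "bounded (U ` frontier K)"
    using cpt U by (intro compact_imp_bounded compact_continuous_image) (auto intro: continuous_on_subset)
  then obtain B where "\<And>x. x \<in> frontier K \<Longrightarrow> norm (U x) \<le> B" by (auto simp: bounded_iff)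
  moreover have "U \<in> borel_measurable surface_measure"
    using borel_measurable_continuous_onI[OF U] by (simp cong: measurable_cong_sets add: sets)
  ultimately show ?thesis
    unfolding set_integrable_def using K
    by (intro integrableI_bounded_set_indicator[where B = B]) (auto simp: mesh_cell_def sets)
qed

lemma set_integral_linear_combination:
  fixes f :: "'i \<Rightarrow> 'a \<Rightarrow> real"
  assumes "\<And>i. i \<in> I \<Longrightarrow> set_integrable M A (f i)"
  shows "(LINT x:A|M. \<Sum>i\<in>I. c i * f i x) = (\<Sum>i\<in>I. c i * (LINT x:A|M. f i x))"
proof -
  have "(LINT x:A|M. \<Sum>i\<in>I. c i * f i x) = 
      integral\<^sup>L M (\<lambda>x. \<Sum>i\<in>I. c i * (indicator A x *\<^sub>R f i x))"
    unfolding set_lebesgue_integral_def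
    by (intro Bochner_Integration.integral_cong) (auto simp: sum_distrib_left mult_ac)
  also have "\<dots> = (\<Sum>i\<in>I. c i * (LINT x:A|M. f i x))"
    using assms unfolding set_integrable_def set_lebesgue_integral_def
    by (subst Bochner_Integration.integral_sum) auto
  finally show ?thesis .
qed

lemma polynomial_zero_if_cell_integral_zero:
  fixes K :: "(real ^ 'n::finite) set"
  assumes K: "mesh_cell K" and U: "real_polynomial_function U"
    and nonneg: "\<And>x. x \<in> K \<Longrightarrow> 0 \<le> U x" and int: "cell_integral K U \<le> 0"
  shows "U x = 0"
proof (rule polynomial_zero_on_open[OF U])
  have "compact K" "interior K \<noteq> {}" using K by (auto simp: mesh_cell_def)
  show "open (interior K)" by simp
  show "interior K \<noteq> {}" by fact
  let ?f = "\<lambda>x. indicator K x *\<^sub>R U x"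
  have "integrable lborel ?f"
    using cell_set_integrable[OF \<open>compact K\<close> polynomial_continuous_on[OF U]]
    by (simp add: set_integrable_def)
  moreover have f0: "AE x in lborel. 0 \<le> ?f x"
    using nonneg by (auto simp: indicator_def)
  moreover have "integral\<^sup>L lborel ?f = 0"
    using integral_nonneg_AE[OF f0] int by (simp add: cell_integral_def set_lebesgue_integral_def)
  ultimately have "AE x in lborel. ?f x = 0"
    using integral_nonneg_eq_0_iff_AE by blast
  then have "AE x in lebesgue. ?f x = 0" by (rule AE_completion)
  then have "AE x\<in>interior K in lebesgue. x \<in> {x. U x = 0}"
    using interior_subset[of K] by (auto simp: indicator_def elim!: eventually_mono)
  moreover have "closed {x. U x = 0}"
    by (intro closed_Collect_eq polynomial_continuous_on[OF U] continuous_on_const)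
  ultimately show "U x = 0" if "x \<in> interior K" for x
    using mem_closed_if_AE_lebesgue_open[OF open_interior, of "{x. U x = 0}" K x] that by simp
qed

text \<open>Coordinates with respect to a basis, with sums taken pointwise instead of in the function space.\<close>

lemma finite_dim_basis:
  assumes "finite_dim_polynomial_space V"
  obtains I :: "(real ^ 'n::finite \<Rightarrow> real) set" where "finite I" "I \<subseteq> V"
    "\<And>c b. (\<And>x. (\<Sum>b\<in>I. c b * b x) = 0) \<Longrightarrow> b \<in> I \<Longrightarrow> c b = 0"
    "\<And>U. U \<in> V \<longleftrightarrow> (\<exists>c. U = (\<lambda>x. \<Sum>b\<in>I. c b * b x))"
proof -
  have sum_apply: "(\<Sum>b\<in>I. (\<lambda>x. c b * b x)) = (\<lambda>x. \<Sum>b\<in>I. c b * b x)"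
    for I and c :: "(real ^ 'n \<Rightarrow> real) \<Rightarrow> real"
    by (induction I rule: infinite_finite_induct) (auto simp: fun_eq_iff)
  from assms obtain B where B: "finite B" "fun_vs.span B = V" "fun_vs.subspace V"
    by (auto simp: finite_dim_polynomial_space_def)
  obtain I where I: "I \<subseteq> B" "fun_vs.independent I" "B \<subseteq> fun_vs.span I"
    using fun_vs.maximal_independent_subset by blast
  have fin: "finite I" using I B finite_subset by blast
  have "fun_vs.span I = V"
    using fun_vs.span_mono[OF I(1)] fun_vs.span_minimal[OF I(3) fun_vs.subspace_span] B by auto
  show thesis
  proof
    show "finite I" by fact
    show "I \<subseteq> V" using I(1) B(2) fun_vs.span_superset by blast
    show "c b = 0" if "\<And>x. (\<Sum>b\<in>I. c b * b x) = 0" "b \<in> I" for c b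
      using fun_vs.independentD[OF I(2) fin order_refl _ that(2), of c] that(1)
      by (simp add: sum_apply fun_eq_iff)
    show "U \<in> V \<longleftrightarrow> (\<exists>c. U = (\<lambda>x. \<Sum>b\<in>I. c b * b x))" for U
      unfolding \<open>fun_vs.span I = V\<close>[symmetric] fun_vs.span_finite[OF fin] sum_apply by auto
  qed
qed

lemma const_one_in_polynomials: "(\<lambda>x :: real ^ 'n::finite. 1) \<in> polynomials_degree_le k"
proof -
  have "monomial_fun (\<lambda>_. 0) = (\<lambda>x :: real ^ 'n. 1)" by (simp add: fun_eq_iff monomial_fun_def)
  then show ?thesis
    unfolding polynomials_degree_le_def
    by (intro fun_vs.span_base CollectI exI[of _ "\<lambda>_. 0"]) simp
qed

section \<open>The optimal quadrature rule\<close>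

theorem theorem5p6:
  fixes K :: "(real ^ 'n::finite) set"
    and V :: "(real ^ 'n \<Rightarrow> real) set"
    and k :: nat
  assumes "mesh_cell K"
    and "finite_dim_polynomial_space V"
    and "polynomials_degree_le k \<subseteq> V"
  shows "\<exists>(X :: (real ^ 'n) set) (w :: real ^ 'n \<Rightarrow> real) (W :: real).
           finite X \<and> X \<subseteq> K \<and> (\<forall>x\<in>X. 0 \<le> w x) \<and> 0 < W \<and>
           (\<forall>U\<in>V. cell_integral K U = (\<Sum>x\<in>X. w x * U x) + W * boundary_integral K U) \<and>
           optimal_interior_weight V K = ereal (inverse W)"
proof -
  let ?C = "cell_integral K" and ?B = "boundary_integral K" and ?P = "positive_cone V K"
  have K: "compact K" "K \<noteq> {}"
    using assms(1) interior_subset by (auto simp: mesh_cell_def)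
  have poly: "real_polynomial_function U" if "U \<in> V" for U
    using assms(2) that by (simp add: finite_dim_polynomial_space_def)
  obtain I where I: "finite I" "I \<subseteq> V"
    and indep: "\<And>c b. (\<And>x. (\<Sum>b\<in>I. c b * b x) = 0) \<Longrightarrow> b \<in> I \<Longrightarrow> c b = 0"
    and span: "\<And>U. U \<in> V \<longleftrightarrow> (\<exists>c. U = (\<lambda>x. \<Sum>b\<in>I. c b * b x))"
    using finite_dim_basis[OF assms(2)] by blast
  have cont: "continuous_on A b" if "b \<in> I" for b A
    using that I(2) poly polynomial_continuous_on by blast
  have C_lin: "?C (\<lambda>x. \<Sum>b\<in>I. c b * b x) = (\<Sum>b\<in>I. c b * ?C b)" for c
    unfolding cell_integral_def
    by (intro set_integral_linear_combination cell_set_integrable K cont)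
  have B_lin: "?B (\<lambda>x. \<Sum>b\<in>I. c b * b x) = (\<Sum>b\<in>I. c b * ?B b)" for c
    unfolding boundary_integral_def
    by (intro set_integral_linear_combination boundary_set_integrable assms(1) cont)
  have one: "(\<lambda>x. 1) \<in> V" using assms(3) const_one_in_polynomials by blast
  then obtain c1 where c1: "(\<lambda>x. 1) = (\<lambda>x. \<Sum>b\<in>I. c1 b * b x)" using span by blast

  have C_pos: "0 < ?C U" if "U \<in> V" "\<forall>x\<in>K. 0 \<le> U x" "U y \<noteq> 0" for U y
    using polynomial_zero_if_cell_integral_zero[OF assms(1) poly[OF that(1)], of y] that
    by (meson not_le)
  have one_P: "(\<lambda>x. 1) \<in> ?P" using one C_pos[OF one] by (simp add: positive_cone_def)
  then have C1: "0 < ?C (\<lambda>x. 1)" by (simp add: positive_cone_def)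
  have B1: "0 < ?B (\<lambda>x. 1)"
  proof -
    have "?B (\<lambda>x. 1) = measure surface_measure (frontier K)"
      unfolding boundary_integral_def set_lebesgue_integral_def surface_measure_def by simp
    then show ?thesis
      using assms(1) by (simp add: mesh_cell_def measure_def enn2real_positive_iff)
  qed

  have "\<exists>M. \<forall>c. (\<forall>x\<in>K. 0 \<le> (\<Sum>b\<in>I. c b * b x)) \<longrightarrow>
      (\<Sum>b\<in>I. c b * ?B b) \<le> M * (\<Sum>b\<in>I. c b * ?C b)"
  proof (rule positive_functional_dominates[OF I(1)])
    fix c assume c: "\<forall>x\<in>K. 0 \<le> (\<Sum>b\<in>I. c b * b x)" "\<exists>b\<in>I. c b \<noteq> 0"
    then obtain y where "(\<Sum>b\<in>I. c b * b y) \<noteq> 0" using indep by blast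
    with C_pos[OF _ c(1)] span show "0 < (\<Sum>b\<in>I. c b * ?C b)" unfolding C_lin[symmetric] by blast
  qed
  then obtain M0 where M0_coord: "\<And>c. \<forall>x\<in>K. 0 \<le> (\<Sum>b\<in>I. c b * b x) \<Longrightarrow>
      (\<Sum>b\<in>I. c b * ?B b) \<le> M0 * (\<Sum>b\<in>I. c b * ?C b)"
    by blast
  have M0: "?B U \<le> M0 * ?C U" if U: "U \<in> V" "\<forall>x\<in>K. 0 \<le> U x" for U
  proof -
    from span[of U] U(1) obtain c where c: "U = (\<lambda>x. \<Sum>b\<in>I. c b * b x)" by auto
    show ?thesis using M0_coord[of c] U(2) unfolding c B_lin C_lin by blast
  qed

  define M where "M = (SUP U\<in>?P. ?B U / ?C U)"
  have bdd: "bdd_above ((\<lambda>U. ?B U / ?C U) ` ?P)"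
    using M0 by (auto simp: bdd_above_def positive_cone_def divide_le_eq intro!: exI[of _ M0])
  have "?B (\<lambda>x. 1) / ?C (\<lambda>x. 1) \<le> M"
    unfolding M_def by (rule cSUP_upper[OF one_P bdd])
  then have M_pos: "0 < M" using B1 C1 by (meson divide_pos_pos less_le_trans)
  have weight: "optimal_interior_weight V K = ereal M"
  proof -
    let ?S = "SUP U\<in>?P. ereal (?B U / ?C U)"
    have "ereal (?B (\<lambda>x. 1) / ?C (\<lambda>x. 1)) \<le> ?S"
      using one_P by (rule SUP_upper)
    moreover have "?S \<le> ereal M"
      unfolding M_def using cSUP_upper[OF _ bdd] by (intro SUP_least) simp
    ultimately have "\<bar>?S\<bar> \<noteq> \<infinity>" by auto
    then show ?thesis
      unfolding optimal_interior_weight_def M_def by (rule ereal_SUP[symmetric])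
  qed

  have L_lin: "?C (\<lambda>x. \<Sum>b\<in>I. c b * b x) - inverse M * ?B (\<lambda>x. \<Sum>b\<in>I. c b * b x)
      = (\<Sum>b\<in>I. c b * (?C b - inverse M * ?B b))" for c
    unfolding C_lin B_lin by (simp add: right_diff_distrib sum_subtractf sum_distrib_left mult_ac)
  have "(\<lambda>b. ?C b - inverse M * ?B b) \<in> moment_cone I (\<lambda>b. b) K"
  proof (rule moment_cone_dual[OF I(1) K, where c = c1])
    show "continuous_on K b" if "b \<in> I" for b using that by (rule cont)
    show "(\<Sum>b\<in>I. c1 b * b x) = 1" for x using fun_cong[OF c1, of x] by simp
  next
    fix c assume c: "\<forall>x\<in>K. 0 \<le> (\<Sum>b\<in>I. c b * b x)"
    define U where "U x = (\<Sum>b\<in>I. c b * b x)" for x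
    have U: "U \<in> V" "\<forall>x\<in>K. 0 \<le> U x" using span c by (auto simp: U_def fun_eq_iff)
    have "?B U \<le> M * ?C U"
    proof (cases "U \<in> ?P")
      case True
      then have "?B U / ?C U \<le> M" unfolding M_def by (rule cSUP_upper[OF _ bdd])
      then show ?thesis using True by (simp add: positive_cone_def divide_le_eq)
    next
      case False
      then have "U = (\<lambda>x. 0)" using C_pos[OF U] U by (fastforce simp: positive_cone_def)
      then show ?thesis
        by (simp add: boundary_integral_def cell_integral_def set_lebesgue_integral_def)
    qed
    then have "0 \<le> ?C U - inverse M * ?B U" using M_pos by (simp add: field_simps)
    also have "\<dots> = (\<Sum>b\<in>I. c b * (?C b - inverse M * ?B b))"
      unfolding U_def by (rule L_lin)
    finally show "0 \<le> (\<Sum>b\<in>I. c b * (?C b - inverse M * ?B b))" .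
  qed
  then obtain X w where X: "finite X" "X \<subseteq> K" "\<forall>x\<in>X. 0 \<le> w x"
    and Xw: "\<And>b. b \<in> I \<Longrightarrow> ?C b - inverse M * ?B b = (\<Sum>x\<in>X. w x * b x)"
    by (auto simp: moment_cone_def)
  have "?C U = (\<Sum>x\<in>X. w x * U x) + inverse M * ?B U" if "U \<in> V" for U
  proof -
    from span[of U] that obtain c where c: "U = (\<lambda>x. \<Sum>b\<in>I. c b * b x)" by auto
    have "?C U - inverse M * ?B U = (\<Sum>b\<in>I. c b * (?C b - inverse M * ?B b))"
      unfolding c by (rule L_lin)
    also have "\<dots> = (\<Sum>b\<in>I. \<Sum>x\<in>X. w x * (c b * b x))"
      by (simp add: Xw sum_distrib_left mult_ac)
    also have "\<dots> = (\<Sum>x\<in>X. \<Sum>b\<in>I. w x * (c b * b x))" by (rule sum.swap)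
    also have "\<dots> = (\<Sum>x\<in>X. w x * U x)"
      by (simp add: c sum_distrib_left)
    finally show ?thesis by simp
  qed
  with X M_pos weight show ?thesis
    by (intro exI[of _ X] exI[of _ w] exI[of _ "inverse M"]) auto
qed
end
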